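(* For every integer $n\geq 3$, the $n\times n$ circulant matrix $\mathbb{Q}=\mathrm{circ}(Q_1,Q_2,\ldots,Q_n)$, where $Q_k$ is the $k$th Pell-Lucas number, is invertible.
   Context: The Pell-Lucas numbers are defined by $Q_0=2$, $Q_1=2$, and $Q_k=2Q_{k-1}+Q_{k-2}$ for $k\geq 2$. For numbers $c_0,c_1,\ldots,c_{n-1}$, $\mathrm{circ}(c_0,c_1,\ldots,c_{n-1})$ denotes the $n\times n$ circulant matrix whose first row is $(c_0,c_1,\ldots,c_{n-1})$ and in which each subsequent row is the cyclic shift of the previous row one position to the right; i.e. its $(i,j)$ entry is $c_{(j-i)\bmod n}$ for $1\le i,j\le n$. *)

theory Defs
  imports Complex_Main "Jordan_Normal_Form.Matrix"
begin

fun pell_lucas :: "nat \<Rightarrow> nat" where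
  "pell_lucas 0 = 2"
| "pell_lucas (Suc 0) = 2"
| "pell_lucas (Suc (Suc k)) = 2 * pell_lucas (Suc k) + pell_lucas k"

(* Rows and columns are indexed from 0, which leaves j - i unchanged. The subtraction is
   done in int because it would truncate in nat; mod on int has its result in {0..<n}. *)
definition circ :: "'a list \<Rightarrow> 'a mat" where
  "circ cs = (let n = length cs in
     mat n n (\<lambda>(i, j). cs ! nat ((int j - int i) mod int n)))"

end

theory Submission
  imports Defs "Jordan_Normal_Form.Determinant"
begin

text \<open>
  A kernel vector of the circulant matrix is an \<open>n\<close>-periodic sequence \<open>w\<close> all of whose
  convolutions with \<open>Q\<^sub>1, \<dots>, Q\<^sub>n\<close> vanish. The recurrence makes the combination of three
  consecutive convolutions telescope to
  \<open>(Q\<^bsub>n+1\<^esub> - 2) w\<^sub>i + (Q\<^sub>n - 2) w\<^bsub>i+1\<^esub> = 0\<close>. As \<open>Q\<^bsub>n+1\<^esub> > Q\<^sub>n \<ge> 2\<close>,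
  this fails at an index where \<open>\<bar>w\<bar>\<close> is maximal unless \<open>w = 0\<close>.
\<close>

lemma pell_lucas_ge_2: "2 \<le> pell_lucas k"
  by (induction k rule: pell_lucas.induct) auto

text \<open>Strictness starts only at index 1, since Q_0 = Q_1 = 2.\<close>

lemma pell_lucas_less_Suc: "0 < k \<Longrightarrow> pell_lucas k < pell_lucas (Suc k)"
  using pell_lucas_ge_2[of k] by (cases k) (auto intro: less_le_trans)

text \<open>For 2 \<le> j < n the coefficient of \<open>w j\<close> is Q_{j+1} - 2 Q_j - Q_{j-1} =
  0, so only boundary terms survive.\<close>

lemma pell_lucas_sum_telescope:
  fixes w :: "nat \<Rightarrow> 'a::comm_ring_1"
  shows "(\<Sum>k<n. of_nat (pell_lucas (Suc k)) * (w k - 2 * w (Suc k) - w (Suc (Suc k)))) =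
    2 * w 0 + 2 * w 1 - of_nat (pell_lucas (Suc n)) * w n - of_nat (pell_lucas n) * w (Suc n)"
  by (induction n) (simp_all add: algebra_simps)

lemma circ_carrier_mat: "circ cs \<in> carrier_mat (length cs) (length cs)"
  by (simp add: circ_def Let_def)

text \<open>Substituting k = (j - i) mod n moves the cyclic shift from the matrix row to the vector,
  so every row carries the same coefficients and different rows can be combined.\<close>

lemma circ_mult_vec_index:
  fixes cs :: "'a::comm_semiring_0 list"
  assumes v: "v \<in> carrier_vec (length cs)" and i: "i < length cs"
  shows "(circ cs *\<^sub>v v) $ i = (\<Sum>k<length cs. cs ! k * v $ ((i + k) mod length cs))"
proof -
  define n where "n = length cs"
  have n: "i < n" using i by (simp add: n_def)
  have "(circ cs *\<^sub>v v) $ i = (\<Sum>j<n. cs ! nat ((int j - int i) mod int n) * v $ j)"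
    using assms by (simp add: circ_def Let_def n_def scalar_prod_def atLeast0LessThan)
  also have "\<dots> = (\<Sum>k<n. cs ! k * v $ ((i + k) mod n))"
  proof (rule sum.reindex_bij_witness[where i = "\<lambda>k. (i + k) mod n"
        and j = "\<lambda>j. nat ((int j - int i) mod int n)"])
    fix j assume j: "j \<in> {..<n}"
    have "int ((i + nat ((int j - int i) mod int n)) mod n) = int j"
      using j n by (simp add: zmod_int mod_add_right_eq)
    then show eq: "(i + nat ((int j - int i) mod int n)) mod n = j"
      by linarith
    show "nat ((int j - int i) mod int n) \<in> {..<n}"
      using n by (simp add: nat_less_iff)
    show "cs ! nat ((int j - int i) mod int n) * v $ ((i + nat ((int j - int i) mod int n)) mod n)
        = cs ! nat ((int j - int i) mod int n) * v $ j"
      by (simp only: eq)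
  next
    fix k assume k: "k \<in> {..<n}"
    show "(i + k) mod n \<in> {..<n}" using n by simp
    show "nat ((int ((i + k) mod n) - int i) mod int n) = k"
      using k n by (simp add: zmod_int mod_diff_left_eq)
  qed
  finally show ?thesis by (simp add: n_def)
qed

lemma periodic_geometric_eq_0:
  fixes w :: "nat \<Rightarrow> real"
  assumes n: "0 < n" and per: "\<And>i. w (i mod n) = w i"
    and ab: "0 \<le> b" "b < a" and rec: "\<And>i. a * w i + b * w (Suc i) = 0"
  shows "w i = 0"
proof -
  have "Max ((\<lambda>i. \<bar>w i\<bar>) ` {..<n}) \<in> (\<lambda>i. \<bar>w i\<bar>) ` {..<n}"
    using n by (intro Max_in) auto
  then obtain m where m: "\<bar>w m\<bar> = Max ((\<lambda>i. \<bar>w i\<bar>) ` {..<n})"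
    by auto
  have max: "\<bar>w j\<bar> \<le> \<bar>w m\<bar>" for j
  proof -
    have "\<bar>w (j mod n)\<bar> \<le> \<bar>w m\<bar>"
      unfolding m using n by (intro Max_ge) auto
    then show ?thesis by (simp only: per)
  qed
  \<comment> \<open>Taking absolute values and using maximality at \<open>m\<close> gives a factor
    \<open>a - b\<close> > 0 that forces \<open>w m\<close> to vanish.\<close>
  have "a * w m = - (b * w (Suc m))"
    using rec[of m] by linarith
  then have "a * \<bar>w m\<bar> = b * \<bar>w (Suc m)\<bar>"
    using ab by (metis abs_minus_cancel abs_mult abs_of_nonneg less_eq_real_def order.trans)
  also have "\<dots> \<le> b * \<bar>w m\<bar>"
    using ab max by (simp add: mult_left_mono)
  finally have "(a - b) * \<bar>w m\<bar> \<le> 0"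
    by (simp add: algebra_simps)
  then have "\<bar>w m\<bar> \<le> 0"
    using ab by (simp add: mult_le_0_iff)
  then show ?thesis using max[of i] by linarith
qed

lemma circ_pell_lucas_kernel:
  assumes n: "0 < n" and v: "v \<in> carrier_vec n"
    and ker: "circ (map (\<lambda>k. real (pell_lucas k)) [1..<Suc n]) *\<^sub>v v = 0\<^sub>v n"
  shows "v = 0\<^sub>v n"
proof -
  define w where "w i = v $ (i mod n)" for i
  define S where "S i = (\<Sum>k<n. real (pell_lucas (Suc k)) * w (i + k))" for i
  \<comment> \<open>Entry \<open>k\<close> of the list is Q_{k+1}, so \<open>S i\<close> is row
    \<open>i\<close> of the product.\<close>
  have "S i = 0" if "i < n" for i
    using circ_mult_vec_index[of v "map (\<lambda>k. real (pell_lucas k)) [1..<Suc n]" i] v that ker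
    by (simp add: S_def w_def del: upt_Suc)
  \<comment> \<open>The three-term combination reaches \<open>S (Suc i)\<close> and
    \<open>S (Suc (Suc i))\<close>, whose indices may leave the range of rows; periodicity covers
    them.\<close>
  moreover have "S (i mod n) = S i" for i
    by (simp add: S_def w_def mod_add_left_eq)
  ultimately have S0: "S i = 0" for i
    using n by (metis mod_less_divisor)
  have "(real (pell_lucas (Suc n)) - 2) * w i + (real (pell_lucas n) - 2) * w (Suc i) = 0" for i
  proof -
    have "S i - 2 * S (Suc i) - S (Suc (Suc i)) =
        2 * w i + 2 * w (Suc i) - real (pell_lucas (Suc n)) * w (i + n)
          - real (pell_lucas n) * w (Suc (i + n))"
      using pell_lucas_sum_telescope[of "\<lambda>k. w (i + k)" n]
      by (simp add: S_def sum_subtractf sum.distrib sum_distrib_left algebra_simps)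
    \<comment> \<open>Periodicity merges the terms at the far boundary with those at the near
      one.\<close>
    moreover have "w (i + n) = w i" "w (Suc (i + n)) = w (Suc i)"
      using mod_add_self2[of "Suc i" n] by (simp_all add: w_def)
    ultimately show ?thesis
      by (simp add: S0 algebra_simps)
  qed
  moreover have "w (i mod n) = w i" for i
    by (simp add: w_def)
  ultimately have w0: "w i = 0" for i
    using n pell_lucas_ge_2[of n] pell_lucas_less_Suc[of n]
    by (intro periodic_geometric_eq_0[of n w "real (pell_lucas n) - 2"
          "real (pell_lucas (Suc n)) - 2"]) auto
  show ?thesis
  proof (rule eq_vecI)
    fix i assume "i < dim_vec (0\<^sub>v n :: real vec)"
    then show "v $ i = 0\<^sub>v n $ i" using w0[of i] by (simp add: w_def)
  qed (use v in simp)
qed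

lemma invertible_mat_if_kernel_trivial:
  fixes A :: "'a::field mat"
  assumes A: "A \<in> carrier_mat n n"
    and ker: "\<And>v. v \<in> carrier_vec n \<Longrightarrow> A *\<^sub>v v = 0\<^sub>v n \<Longrightarrow> v = 0\<^sub>v n"
  shows "invertible_mat A"
proof -
  have "det A \<noteq> 0"
    using det_0_iff_vec_prod_zero[OF A] ker by blast
  \<comment> \<open>The \<open>()\<close> merely fills the record extension slot of
    \<open>ring_mat\<close>.\<close>
  from det_non_zero_imp_unit[OF A this, of "()"]
  obtain B where "B \<in> carrier_mat n n" "B * A = 1\<^sub>m n" "A * B = 1\<^sub>m n"
    by (auto simp: Units_def ring_mat_def)
  then show ?thesis
    using A by (auto simp: invertible_mat_def inverts_mat_def)
qed

theorem theorem7: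
  fixes n :: nat
  assumes "n \<ge> 3"
  shows "invertible_mat (circ (map (\<lambda>k. real (pell_lucas k)) [1..<Suc n]))"
proof (rule invertible_mat_if_kernel_trivial)
  show "circ (map (\<lambda>k. real (pell_lucas k)) [1..<Suc n]) \<in> carrier_mat n n"
    using circ_carrier_mat[of "map (\<lambda>k. real (pell_lucas k)) [1..<Suc n]"]
    by (simp del: upt_Suc)
qed (use assms in \<open>auto intro: circ_pell_lucas_kernel simp del: upt_Suc\<close>)

end
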